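(* Let $p,q$ be complex numbers. The generating function of the even-indexed $(p,q)$-Pell Lucas numbers is, as a formal power series in $z$, $$\sum_{n=0}^{\infty}Q_{p,q,2n}z^n=\frac{2-2(2p^2+q)z}{1-2(2p^2+q)z+q^2z^2}.$$
   Context: The $(p,q)$-Pell Lucas numbers are defined by $Q_{p,q,0}=2$, $Q_{p,q,1}=2p$, and $Q_{p,q,n}=2pQ_{p,q,n-1}+qQ_{p,q,n-2}$ for $n\ge 2$. *)

theory Defs
  imports Complex_Main "HOL-Computational_Algebra.Formal_Power_Series"
begin

fun pell_lucas :: "complex \<Rightarrow> complex \<Rightarrow> nat \<Rightarrow> complex" where
  "pell_lucas p q 0 = 2"
| "pell_lucas p q (Suc 0) = 2 * p"
| "pell_lucas p q (Suc (Suc n)) = 2 * p * pell_lucas p q (Suc n) + q * pell_lucas p q n"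

end

theory Submission
  imports Defs
begin

text \<open>Taking every second term of a linear recurrence of order two gives another one, here
  with coefficients \<open>2 * (2 * p^2 + q)\<close> and \<open>- q^2\<close>
  (\<open>pell_lucas_step_two\<close>). Multiplying the series by the denominator therefore kills
  all coefficients from degree 2 on; those in degrees 0 and 1 come from the initial values
  (\<open>pell_lucas_two\<close>) and form the numerator.\<close>

text \<open>If a and b are the roots of x^2 = 2px + q, even indices see a^2 and b^2, with sum (2p)^2
  + 2q and product q^2. The proof needs no roots: unfolding reduces both sides to the terms at
  \<open>Suc n\<close> and \<open>n\<close>.\<close>

lemma pell_lucas_step_two:
  "pell_lucas p q (Suc (Suc (Suc (Suc n)))) =
    2 * (2 * p^2 + q) * pell_lucas p q (Suc (Suc n)) - q^2 * pell_lucas p q n"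
  by (simp add: power2_eq_square algebra_simps)

lemma pell_lucas_two: "pell_lucas p q 2 = 2 * (2 * p^2 + q)"
  by (simp add: numeral_2_eq_2 algebra_simps)

theorem theorem8:
  fixes p q :: complex
  shows "Abs_fps (\<lambda>n. pell_lucas p q (2 * n)) =
    (2 - fps_const (2 * (2 * p^2 + q)) * fps_X) /
    (1 - fps_const (2 * (2 * p^2 + q)) * fps_X + fps_const (q^2) * fps_X^2)"
proof -
  define c where "c = 2 * (2 * p^2 + q)"
  define F where "F = Abs_fps (\<lambda>n. pell_lucas p q (2 * n))"
  define D where "D = 1 - fps_const c * fps_X + fps_const (q^2) * fps_X^2"
  have "fps_nth D 0 = 1"
    by (simp add: D_def)
  then have "D \<noteq> 0"
    by auto
  \<comment> \<open>In this form each summand is a scaled shift of \<open>F\<close>, so coefficients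
    can be read off without convolution sums.\<close>
  have expand: "F * D = F - fps_const c * (fps_X * F) + fps_const (q^2) * (fps_X^2 * F)"
    by (simp add: D_def algebra_simps)
  have "F * D = 2 - fps_const c * fps_X"
  proof (rule fps_ext)
    fix n :: nat
    consider "n = 0" | "n = 1" | m where "n = m + 2"
      by (metis One_nat_def add_2_eq_Suc' not0_implies_Suc)
    then show "fps_nth (F * D) n = fps_nth (2 - fps_const c * fps_X) n"
    proof cases
      case 1
      then show ?thesis
        by (simp add: D_def F_def numeral_fps_const)
    next
      case 2
      then show ?thesis
        unfolding expand
        by (simp add: F_def c_def fps_X_power_mult_nth numeral_fps_const
            del: pell_lucas.simps(3))
          (simp add: pell_lucas_two algebra_simps)
    next
      case 3
      then show ?thesis
        \<comment> \<open>The shifts leave the terms at \<open>2*m+4\<close>, \<open>2*m+2\<close>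
          and \<open>2*m\<close>; the defining equations stay folded so that these match the
          two-step recurrence.\<close>
        using pell_lucas_step_two[of p q "2 * m"] unfolding expand
        by (simp add: F_def c_def fps_X_power_mult_nth numeral_fps_const
            del: pell_lucas.simps)
    qed
  qed
  then have "F = (2 - fps_const c * fps_X) / D"
    using \<open>D \<noteq> 0\<close> by (metis nonzero_mult_div_cancel_right)
  then show ?thesis
    by (simp only: F_def D_def c_def)
qed

end
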